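(* Let $X$ be an L-ordered metric space. Then the stochastic order on $PX$ is antisymmetric: for all $p,q\in PX$, if $p\le q$ and $q\le p$, then $p=q$.
   Context: An ordered metric space is a metric space $X$ equipped with a partial order $\le$ whose graph $\{\le\}=\{(x,y): x\le y\}\subseteq X\times X$ is closed. A map between metric spaces is short if it is 1-Lipschitz. An ordered metric space $X$ is L-ordered if for all $x,y\in X$: $x\le y$ if and only if $f(x)\le f(y)$ for every short monotone function $f:X\to\mathbb{R}$ ($\mathbb{R}$ with its usual metric and order). $PX$ is the set of Radon probability measures $p$ on $X$ of finite first moment, i.e. such that $\int f\,dp$ exists and is finite for every short $f:X\to\mathbb{R}$. A coupling of $p$ and $q$ is a probability measure on $X\times X$ whose first and second marginals are $p$ and $q$. Stochastic order: for $p,q\in PX$, $p\le q$ if and only if there is a coupling $r$ of $p$ and $q$ supported on the closed set $\{\le\}$ (i.e. the complement of $\{\le\}$ has $r$-measure zero). *)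

theory Defs
  imports "HOL-Probability.Probability"
begin

locale ordered_metric_space =
  fixes le :: "'a::metric_space \<Rightarrow> 'a \<Rightarrow> bool"
  assumes reflp_le: "reflp le"
    and antisymp_le: "antisymp le"
    and transp_le: "transp le"
    and closed_graph: "closed {(x, y). le x y}"

definition short :: "('a::metric_space \<Rightarrow> 'b::metric_space) \<Rightarrow> bool" where
  "short f \<longleftrightarrow> 1-lipschitz_on UNIV f"

locale L_ordered_metric_space = ordered_metric_space le
  for le :: "'a::metric_space \<Rightarrow> 'a \<Rightarrow> bool" +
  assumes L_ordered:
    "le x y \<longleftrightarrow> (\<forall>f :: 'a \<Rightarrow> real. short f \<and> monotone le (\<le>) f \<longrightarrow> f x \<le> f y)"

definition radon_prob :: "'a::metric_space measure \<Rightarrow> bool" where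
  "radon_prob p \<longleftrightarrow> prob_space p \<and> sets p = sets borel \<and>
     (\<forall>A \<in> sets borel. emeasure p A = (SUP K \<in> {K. compact K \<and> K \<subseteq> A}. emeasure p K))"

definition PX :: "'a::metric_space measure set" where
  "PX = {p. radon_prob p \<and> (\<forall>f :: 'a \<Rightarrow> real. short f \<longrightarrow> integrable p f)}"

(* Couplings live on the Borel sigma-algebra of the product space, not on the product of the
   Borel sigma-algebras: without separability the latter may be smaller, and the closed graph
   of the order need not belong to it. *)
definition coupling ::
    "('a::metric_space \<times> 'a) measure \<Rightarrow> 'a measure \<Rightarrow> 'a measure \<Rightarrow> bool" where
  "coupling r p q \<longleftrightarrow> prob_space r \<and> sets r = sets borel \<and>
     distr r borel fst = p \<and> distr r borel snd = q"

definition stochastic_le ::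
    "('a::metric_space \<Rightarrow> 'a \<Rightarrow> bool) \<Rightarrow> 'a measure \<Rightarrow> 'a measure \<Rightarrow> bool" where
  "stochastic_le le p q \<longleftrightarrow>
     (\<exists>r. coupling r p q \<and> emeasure r (- {(x, y). le x y}) = 0)"

end

theory Submission
  imports Defs
begin

text \<open>If \<open>p \<le> q \<le> p\<close>, then integrals of short monotone functions against \<open>p\<close> and \<open>q\<close>
  agree, so a coupling \<open>r\<close> of \<open>p\<close> and \<open>q\<close> on the order gives measure zero to each open set
  \<open>{(x, y). f x < f y}\<close> with \<open>f\<close> short and monotone. L-orderedness says that these sets cover
  the order minus the diagonal, and as \<open>r\<close> inherits tightness from its marginals, finite
  subcovers of compact sets suffice to conclude that \<open>r\<close> is carried by the diagonal.\<close>

text \<open>Countable subadditivity says nothing about an arbitrary family of null open sets.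
  Compactness cuts the family down to finitely many members, whose union is null. In the application
  the family is indexed by short monotone functions.\<close>

lemma compact_null_of_open_null_cover:
  assumes "sets M = sets borel" "compact C"
    and cover: "\<And>z. z \<in> C \<Longrightarrow> \<exists>U. open U \<and> z \<in> U \<and> emeasure M U = 0"
  shows "emeasure M C = 0"
proof -
  define \<U> where "\<U> = {U. open U \<and> emeasure M U = 0}"
  have "\<And>U. U \<in> \<U> \<Longrightarrow> open U" "C \<subseteq> \<Union>\<U>"
    using cover by (auto simp: \<U>_def)
  from compactE[OF \<open>compact C\<close> this(2,1)]
  obtain D where D: "D \<subseteq> \<U>" "finite D" "C \<subseteq> \<Union>D"
    by blast
  have "\<Union>D \<in> null_sets M"
  proof (rule null_sets.finite_Union)
    show "D \<subseteq> null_sets M"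
      using D(1) assms(1) by (auto simp: \<U>_def null_sets_def)
  qed (fact D(2))
  moreover have "\<Union>D \<in> sets M"
    using calculation by blast
  ultimately show ?thesis
    using emeasure_mono[OF D(3), of M] by (simp add: null_sets_def)
qed

text \<open>Inner regularity applied to the whole space: compact sets have mass arbitrarily close to
  1.\<close>

lemma radon_prob_tight:
  assumes "radon_prob p" "0 < (e::real)"
  obtains K where "compact K" "measure p (- K) < e"
proof -
  interpret prob_space p using assms(1) by (simp add: radon_prob_def)
  have sets: "sets p = sets borel" using assms(1) by (simp add: radon_prob_def)
  then have space: "space p = UNIV" by (metis sets_eq_imp_space_eq space_borel)
  have "(SUP K \<in> {K. compact K \<and> K \<subseteq> UNIV}. emeasure p K) = emeasure p UNIV"
    using assms(1) unfolding radon_prob_def by (metis sets.top space_borel)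
  also have "\<dots> = 1" using emeasure_space_1 space by simp
  \<comment> \<open>If e > 1, then \<open>ennreal\<close> truncates 1 - e to 0, which is still below
    1.\<close>
  also have "ennreal (1 - e) < 1"
    using assms(2) by (simp add: ennreal_less_one_iff)
  finally have "ennreal (1 - e) < (SUP K \<in> {K. compact K \<and> K \<subseteq> UNIV}. emeasure p K)"
    by simp
  then obtain K where K: "compact K" "ennreal (1 - e) < emeasure p K"
    unfolding less_SUP_iff by auto
  then have "1 - e < measure p K"
    by (metis emeasure_eq_measure ennreal_leI not_less)
  moreover have "measure p (- K) = 1 - measure p K"
    using prob_compl[of K] K(1) sets space by (simp add: Compl_eq_Diff_UNIV compact_imp_closed)
  ultimately show ?thesis using that K(1) by simp
qed

lemma short_continuous_measurable:
  fixes f :: "'a::metric_space \<Rightarrow> real"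
  assumes "short f"
  shows "continuous_on UNIV f" "f \<in> borel_measurable borel"
  using assms lipschitz_on_continuous_on borel_measurable_continuous_onI
  unfolding short_def by blast+

lemma fst_borel_measurable: "fst \<in> borel_measurable borel"
  and snd_borel_measurable: "snd \<in> borel_measurable borel"
  by (intro borel_measurable_continuous_onI continuous_intros)+

lemma coupling_integral:
  fixes f :: "'a::metric_space \<Rightarrow> real"
  assumes "coupling r p q" "p \<in> PX" "q \<in> PX" "short f"
  shows "integrable r (\<lambda>z. f (fst z))" "integrable r (\<lambda>z. f (snd z))"
    and "integral\<^sup>L r (\<lambda>z. f (fst z)) = integral\<^sup>L p f"
    and "integral\<^sup>L r (\<lambda>z. f (snd z)) = integral\<^sup>L q f"
proof -
  have r: "sets r = sets borel" "distr r borel fst = p" "distr r borel snd = q"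
    using assms(1) by (auto simp: coupling_def)
  have fs: "fst \<in> measurable r borel" "snd \<in> measurable r borel"
    using fst_borel_measurable snd_borel_measurable measurable_cong_sets[OF r(1) refl] by blast+
  have f: "f \<in> borel_measurable borel"
    using short_continuous_measurable[OF assms(4)] by blast
  have "integrable (distr r borel fst) f" "integrable (distr r borel snd) f"
    using assms(2-4) r by (auto simp: PX_def)
  then show "integrable r (\<lambda>z. f (fst z))" "integrable r (\<lambda>z. f (snd z))"
    using integrable_distr_eq fs f by blast+
  show "integral\<^sup>L r (\<lambda>z. f (fst z)) = integral\<^sup>L p f"
    using integral_distr[OF fs(1) f] r by simp
  show "integral\<^sup>L r (\<lambda>z. f (snd z)) = integral\<^sup>L q f"
    using integral_distr[OF fs(2) f] r by simp
qed

lemma (in ordered_metric_space) AE_le_of_coupling: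
  assumes "coupling r p q" "emeasure r (- {(x, y). le x y}) = 0"
  shows "AE z in r. le (fst z) (snd z)"
proof (rule AE_I)
  show "- {(x, y). le x y} \<in> sets r"
    using assms(1) closed_graph by (auto simp: coupling_def)
qed (use assms(2) in auto)

text \<open>Under a coupling on the order, f of the first coordinate is almost everywhere at most f
  of the second, and the marginals turn the integrals of these two functions into those of f against
  p and q.\<close>

lemma (in ordered_metric_space) stochastic_le_integral_mono:
  fixes f :: "'a \<Rightarrow> real"
  assumes "stochastic_le le p q" "p \<in> PX" "q \<in> PX" "short f" "monotone le (\<le>) f"
  shows "integral\<^sup>L p f \<le> integral\<^sup>L q f"
proof -
  obtain r where r: "coupling r p q" "emeasure r (- {(x, y). le x y}) = 0"
    using assms(1) by (auto simp: stochastic_le_def)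
  note int = coupling_integral[OF r(1) assms(2-4)]
  have "integral\<^sup>L r (\<lambda>z. f (fst z)) \<le> integral\<^sup>L r (\<lambda>z. f (snd z))"
    using AE_le_of_coupling[OF r] assms(5)
    by (intro integral_mono_AE int) (auto simp: monotone_def)
  then show ?thesis using int by simp
qed

text \<open>The increment f(y) - f(x) is r-almost everywhere nonnegative, while its r-integral, the
  difference of the integrals of f against q and p, is at most 0 because q is below p. So it
  vanishes almost everywhere. The reverse relation enters only through this inequality; no second
  coupling is composed with r.\<close>

lemma (in ordered_metric_space) coupling_strict_increase_null:
  fixes f :: "'a \<Rightarrow> real"
  assumes "coupling r p q" "emeasure r (- {(x, y). le x y}) = 0"
    and "stochastic_le le q p" "p \<in> PX" "q \<in> PX" "short f" "monotone le (\<le>) f"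
  shows "open {(x, y). f x < f y}" "emeasure r {(x, y). f x < f y} = 0"
proof -
  note int = coupling_integral[OF assms(1,4-6)]
  have cont: "continuous_on UNIV f" using short_continuous_measurable[OF assms(6)] by blast
  then have "open {z. f (fst z) < f (snd z)}"
    by (intro open_Collect_less continuous_on_compose2[OF cont] continuous_intros) auto
  then show op: "open {(x, y). f x < f y}" by (simp add: case_prod_unfold)
  have le: "AE z in r. 0 \<le> f (snd z) - f (fst z)"
    using AE_le_of_coupling[OF assms(1,2)] assms(7) by (auto simp: monotone_def)
  then have "0 \<le> integral\<^sup>L r (\<lambda>z. f (snd z) - f (fst z))"
    by (rule integral_nonneg_AE)
  moreover have "integral\<^sup>L q f \<le> integral\<^sup>L p f"
    by (rule stochastic_le_integral_mono) (use assms in auto)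
  ultimately have "integral\<^sup>L r (\<lambda>z. f (snd z) - f (fst z)) = 0"
    using int by simp
  then have "AE z in r. f (snd z) - f (fst z) = 0"
    using integral_nonneg_eq_0_iff_AE[OF Bochner_Integration.integrable_diff[OF int(2,1)] le]
    by simp
  then have "AE z in r. z \<notin> {(x, y). f x < f y}"
    by eventually_elim auto
  moreover have "{(x, y). f x < f y} \<in> sets r"
    using op assms(1) by (auto simp: coupling_def)
  ultimately show "emeasure r {(x, y). f x < f y} = 0"
    by (simp add: AE_iff_null_sets[symmetric] null_setsD1 AE_iff_null_sets)
qed

lemma (in L_ordered_metric_space) coupling_AE_diagonal:
  assumes r: "coupling r p q" "emeasure r (- {(x, y). le x y}) = 0"
    and qp: "stochastic_le le q p" and pq: "p \<in> PX" "q \<in> PX"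
  shows "AE z in r. fst z = snd z"
proof -
  interpret prob_space r using r(1) by (simp add: coupling_def)
  have sets: "sets r = sets borel" and marg: "distr r borel fst = p" "distr r borel snd = q"
    using r(1) by (auto simp: coupling_def)
  have space: "space r = UNIV" using sets by (metis sets_eq_imp_space_eq space_borel)
  have fs: "fst \<in> measurable r borel" "snd \<in> measurable r borel"
    using fst_borel_measurable snd_borel_measurable measurable_cong_sets[OF sets refl] by blast+
  \<comment> \<open>The order minus the diagonal need not be closed. Keeping a positive distance
    from the diagonal gives closed pieces, which meet compact rectangles in compact sets and exhaust
    the off-diagonal order as n grows.\<close>
  define S where "S n = {z. le (fst z) (snd z) \<and> inverse (real (Suc n)) \<le> dist (fst z) (snd z)}"
    for n
  have closed_S: "closed (S n)" for n
  proof -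
    have "S n = {(x, y). le x y} \<inter> {z. inverse (real (Suc n)) \<le> dist (fst z) (snd z)}"
      by (auto simp: S_def)
    moreover have "closed {z::'a \<times> 'a. inverse (real (Suc n)) \<le> dist (fst z) (snd z)}"
      by (intro closed_Collect_le continuous_intros)
    ultimately show ?thesis using closed_graph by auto
  qed
  have null: "emeasure r ((K \<times> L) \<inter> S n) = 0" if "compact K" "compact L" for K L n
  proof (rule compact_null_of_open_null_cover[OF sets])
    show "compact ((K \<times> L) \<inter> S n)"
      by (intro compact_Int_closed compact_Times that closed_S)
    fix z assume z: "z \<in> (K \<times> L) \<inter> S n"
    obtain x y where xy: "z = (x, y)" by fastforce
    have "le x y" "x \<noteq> y" using z xy by (auto simp: S_def)
    \<comment> \<open>L-orderedness is used for the reversed pair: since y \<le> x fails, some short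
      monotone f violates f y \<le> f x, which puts (x, y) in an open null set.\<close>
    then have "\<not> le y x" using antisymp_le by (auto dest: antisympD)
    then obtain f :: "'a \<Rightarrow> real" where "short f" "monotone le (\<le>) f" "f x < f y"
      using L_ordered[of y x] by (meson not_le)
    then show "\<exists>U. open U \<and> z \<in> U \<and> emeasure r U = 0"
      using coupling_strict_increase_null[OF r qp pq] xy by blast
  qed
  have S_null: "emeasure r (S n) = 0" for n
  proof -
    have "measure r (S n) \<le> 0 + e" if "0 < e" for e
    proof -
      obtain K where K: "compact K" "measure p (- K) < e / 2"
        using radon_prob_tight[of p "e / 2"] pq \<open>0 < e\<close> by (auto simp: PX_def)
      obtain L where L: "compact L" "measure q (- L) < e / 2"
        using radon_prob_tight[of q "e / 2"] pq \<open>0 < e\<close> by (auto simp: PX_def)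
      have KL: "- K \<in> sets borel" "- L \<in> sets borel"
        using K L by (auto simp: compact_imp_closed)
      have ms: "S n \<in> sets r" "(K \<times> L) \<inter> S n \<in> sets r" "fst -` (- K) \<in> sets r" "snd -` (- L) \<in> sets r"
        using closed_S compact_imp_closed[OF compact_Times[OF K(1) L(1)]] sets
          measurable_sets[OF fs(1) KL(1)] measurable_sets[OF fs(2) KL(2)] space by auto
      \<comment> \<open>A pair outside K \<times> L has its first coordinate outside K or its second
        outside L. The r-measures of these two events are marginal measures, each below e /
        2.\<close>
      have "measure r (S n) \<le> measure r ((K \<times> L) \<inter> S n \<union> (fst -` (- K) \<union> snd -` (- L)))"
        using ms by (intro finite_measure_mono) auto
      also have "\<dots> \<le> measure r ((K \<times> L) \<inter> S n) + measure r (fst -` (- K) \<union> snd -` (- L))"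
        using ms by (intro measure_Un_le) auto
      also have "measure r (fst -` (- K) \<union> snd -` (- L)) \<le>
          measure r (fst -` (- K)) + measure r (snd -` (- L))"
        using ms by (intro measure_Un_le) auto
      also have "measure r ((K \<times> L) \<inter> S n) = 0"
        using null[OF K(1) L(1)] by (simp add: measure_def)
      also have "measure r (fst -` (- K)) = measure p (- K)"
        using measure_distr[OF fs(1) KL(1)] marg space by simp
      also have "measure r (snd -` (- L)) = measure q (- L)"
        using measure_distr[OF fs(2) KL(2)] marg space by simp
      finally show ?thesis using K L by simp
    qed
    then have "measure r (S n) \<le> 0" by (rule field_le_epsilon)
    then have "measure r (S n) = 0" by (simp add: order_antisym)
    then show ?thesis by (simp add: emeasure_eq_measure)
  qed
  \<comment> \<open>There are only countably many pieces, so almost every pair avoids all of them.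
    An ordered pair of distinct points would lie in some \<open>S n\<close> by the Archimedean
    property.\<close>
  have "AE z in r. \<forall>n. z \<notin> S n"
    unfolding AE_all_countable
    using S_null closed_S sets by (intro allI AE_not_in) (auto simp: null_sets_def)
  then show ?thesis using AE_le_of_coupling[OF r]
  proof eventually_elim
    case (elim z)
    show ?case
    proof (rule ccontr)
      assume "fst z \<noteq> snd z"
      then obtain n where "inverse (real (Suc n)) < dist (fst z) (snd z)"
        using reals_Archimedean[of "dist (fst z) (snd z)"] by auto
      then show False using elim by (auto simp: S_def dest: less_imp_le)
    qed
  qed
qed

theorem corollary4p3p2:
  fixes le :: "'a::metric_space \<Rightarrow> 'a \<Rightarrow> bool"
  assumes "L_ordered_metric_space le"
  shows "antisymp_on PX (stochastic_le le)"
proof (rule antisymp_onI)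
  interpret L_ordered_metric_space le by fact
  fix p q :: "'a measure"
  assume pq: "p \<in> PX" "q \<in> PX" and le: "stochastic_le le p q" "stochastic_le le q p"
  obtain r where r: "coupling r p q" "emeasure r (- {(x, y). le x y}) = 0"
    using le(1) by (auto simp: stochastic_le_def)
  have sets: "sets r = sets borel" and marg: "distr r borel fst = p" "distr r borel snd = q"
    using r(1) by (auto simp: coupling_def)
  have "fst \<in> measurable r borel" "snd \<in> measurable r borel"
    using fst_borel_measurable snd_borel_measurable measurable_cong_sets[OF sets refl] by blast+
  \<comment> \<open>The two projections agree r-almost everywhere, so they push r forward to the
    same measure.\<close>
  then have "distr r borel fst = distr r borel snd"
    by (intro distr_cong_AE coupling_AE_diagonal[OF r le(2) pq]) auto
  then show "p = q" using marg by simp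
qed

end
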